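(* Let $G$ be an undirected simple graph with vertex set $[n]$ and let $\{X,Y\}$ be a bipartition of $[n]$. Then: (i) $\{X,Y\}$ is a split of $G$ if and only if $\{X,Y\}$ is an HL-bipartition of the adjacency matrix $A(G)$; (ii) $\{X,Y\}$ is a bi-join of $G$ if and only if $\{X,Y\}$ is an HL-bipartition of the Seidel adjacency matrix $S(G)$.
   Context: $[n]:=\{1,\dots,n\}$. A bipartition of a set $V$ is an unordered partition $\{X,Y\}$ of $V$ into two nonempty parts. $N_G(x)$ denotes the set of neighbours of the vertex $x$ in $G$. A bipartition $\{X,Y\}$ of the vertex set is a split of $G$ if there exist (possibly empty) $X_1\subseteq X$ and $Y_1\subseteq Y$ such that $N_G(x)\cap Y=Y_1$ for all $x\in X_1$, and $N_G(x)\cap Y=\emptyset$ for all $x\in X\setminus X_1$. It is a bi-join of $G$ if there exist (possibly empty) $X_1\subseteq X$ and $Y_1\subseteq Y$ such that $N_G(x)\cap Y=Y_1$ for all $x\in X_1$, and $N_G(x)\cap Y=Y\setminus Y_1$ for all $x\in X\setminus X_1$. The adjacency matrix $A(G)=[a_{ij}]$ is the real symmetric $n\times n$ matrix with $a_{ij}=1$ if $\{i,j\}$ is an edge of $G$ and $a_{ij}=0$ otherwise. The Seidel adjacency matrix $S(G)=[s_{ij}]$ is the real symmetric $n\times n$ matrix with $s_{ii}=0$ and, for $i\ne j$, $s_{ij}=-1$ if $\{i,j\}$ is an edge and $s_{ij}=+1$ if it is not. For an $n\times n$ matrix $M$, $M[X,Y]$ denotes the submatrix with row indices in $X$ and column indices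 in $Y$. An HL-bipartition of $M$ is a bipartition $\{X,Y\}$ of $[n]$ such that both $M[X,Y]$ and $M[Y,X]$ have rank at most $1$. *)

theory Defs
  imports
    "Jordan_Normal_Form.DL_Rank_Submatrix"
    "Graph_Theory.Digraph"
    "HOL-Library.Disjoint_Sets"
begin

text \<open>
  Undirected simple graphs are the locale \<^locale>\<open>graph\<close>: finite symmetric digraphs without
  loops and multiple arcs. An edge joining \<open>u\<close> and \<open>v\<close> is thus the pair of arcs between them, and
  adjacency is \<open>u \<rightarrow>\<^bsub>G\<^esub> v\<close>.

  Matrices are indexed from 0, so the index set of an \<open>n \<times> n\<close> matrix, and the vertex set of a graph
  to which a matrix is associated, is \<open>{..<n}\<close> in place of \<open>{1, \<dots>, n}\<close>.
\<close>

text \<open>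
  The condition \<open>X \<noteq> Y\<close> is needed because \<open>{X, Y}\<close> would otherwise collapse to the one-block
  partition. Unordered bipartitions are given by their two parts in either order; all predicates
  below are symmetric in the two parts (for \<open>is_split\<close> and \<open>is_bijoin\<close> this is proved below).
\<close>

definition bipartition :: "'a set \<Rightarrow> 'a set \<Rightarrow> 'a set \<Rightarrow> bool" where
  "bipartition V X Y \<longleftrightarrow> partition_on V {X, Y} \<and> X \<noteq> Y"

definition neighbours :: "('a, 'b) pre_digraph \<Rightarrow> 'a \<Rightarrow> 'a set" where
  "neighbours G x = {y. x \<rightarrow>\<^bsub>G\<^esub> y}"

definition is_split :: "('a, 'b) pre_digraph \<Rightarrow> 'a set \<Rightarrow> 'a set \<Rightarrow> bool" where
  "is_split G X Y \<longleftrightarrow> bipartition (verts G) X Y \<and>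
    (\<exists>X1 Y1. X1 \<subseteq> X \<and> Y1 \<subseteq> Y \<and>
      (\<forall>x\<in>X1. neighbours G x \<inter> Y = Y1) \<and>
      (\<forall>x\<in>X - X1. neighbours G x \<inter> Y = {}))"

definition is_bijoin :: "('a, 'b) pre_digraph \<Rightarrow> 'a set \<Rightarrow> 'a set \<Rightarrow> bool" where
  "is_bijoin G X Y \<longleftrightarrow> bipartition (verts G) X Y \<and>
    (\<exists>X1 Y1. X1 \<subseteq> X \<and> Y1 \<subseteq> Y \<and>
      (\<forall>x\<in>X1. neighbours G x \<inter> Y = Y1) \<and>
      (\<forall>x\<in>X - X1. neighbours G x \<inter> Y = Y - Y1))"

definition adjacency_matrix :: "nat \<Rightarrow> (nat, 'b) pre_digraph \<Rightarrow> real mat" where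
  "adjacency_matrix n G = mat n n (\<lambda>(i, j). if i \<rightarrow>\<^bsub>G\<^esub> j then 1 else 0)"

definition seidel_matrix :: "nat \<Rightarrow> (nat, 'b) pre_digraph \<Rightarrow> real mat" where
  "seidel_matrix n G =
    mat n n (\<lambda>(i, j). if i = j then 0 else if i \<rightarrow>\<^bsub>G\<^esub> j then - 1 else 1)"

text \<open>
  \<^const>\<open>vec_space.rank\<close> takes the dimension of the column vectors, i.e. the number of rows, as an
  explicit argument.
\<close>

definition mat_rank :: "'a::field mat \<Rightarrow> nat" where
  "mat_rank A = vec_space.rank (dim_row A) A"

definition hl_bipartition :: "'a::field mat \<Rightarrow> nat set \<Rightarrow> nat set \<Rightarrow> bool" where
  "hl_bipartition M X Y \<longleftrightarrow> bipartition {..<dim_row M} X Y \<and>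
    mat_rank (submatrix M X Y) \<le> 1 \<and> mat_rank (submatrix M Y X) \<le> 1"

lemma bipartition_commute: "bipartition V X Y \<longleftrightarrow> bipartition V Y X"
  unfolding bipartition_def by (auto simp: insert_commute)

lemma neighbours_sym:
  assumes "graph G"
  shows "y \<in> neighbours G x \<longleftrightarrow> x \<in> neighbours G y"
proof -
  interpret graph G by fact
  show ?thesis
    unfolding neighbours_def mem_Collect_eq by (blast intro: arcs_ends_symmetric[OF sym_arcs])
qed

lemma is_split_swap:
  assumes "graph G" "is_split G X Y"
  shows "is_split G Y X"
proof -
  obtain X1 Y1 where *: "bipartition (verts G) X Y" "X1 \<subseteq> X" "Y1 \<subseteq> Y"
    "\<And>x. x \<in> X1 \<Longrightarrow> neighbours G x \<inter> Y = Y1"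
    "\<And>x. x \<in> X - X1 \<Longrightarrow> neighbours G x \<inter> Y = {}"
    using assms(2) unfolding is_split_def by (elim conjE exE) simp
  have adj: "x \<in> neighbours G y \<longleftrightarrow> x \<in> X1 \<and> y \<in> Y1" if "x \<in> X" "y \<in> Y" for x y
  proof -
    have "x \<in> neighbours G y \<longleftrightarrow> y \<in> neighbours G x \<inter> Y"
      using that neighbours_sym[OF assms(1), of x y] by simp
    then show ?thesis
      using *(4)[of x] *(5)[of x] that by (cases "x \<in> X1") auto
  qed
  have "neighbours G y \<inter> X = (if y \<in> Y1 then X1 else {})" if "y \<in> Y" for y
    using adj[OF _ that] *(2) by (auto simp: set_eq_iff)
  then have "\<forall>y\<in>Y1. neighbours G y \<inter> X = X1" "\<forall>y\<in>Y - Y1. neighbours G y \<inter> X = {}"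
    using *(3) by (simp_all add: subset_iff)
  moreover have "bipartition (verts G) Y X"
    using *(1) by (simp add: bipartition_commute)
  ultimately show ?thesis
    unfolding is_split_def by (intro conjI exI[of _ Y1] exI[of _ X1] *(2,3))
qed

lemma is_bijoin_swap:
  assumes "graph G" "is_bijoin G X Y"
  shows "is_bijoin G Y X"
proof -
  obtain X1 Y1 where *: "bipartition (verts G) X Y" "X1 \<subseteq> X" "Y1 \<subseteq> Y"
    "\<And>x. x \<in> X1 \<Longrightarrow> neighbours G x \<inter> Y = Y1"
    "\<And>x. x \<in> X - X1 \<Longrightarrow> neighbours G x \<inter> Y = Y - Y1"
    using assms(2) unfolding is_bijoin_def by (elim conjE exE) simp
  have adj: "x \<in> neighbours G y \<longleftrightarrow> (x \<in> X1 \<longleftrightarrow> y \<in> Y1)" if "x \<in> X" "y \<in> Y" for x y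
  proof -
    have "x \<in> neighbours G y \<longleftrightarrow> y \<in> neighbours G x \<inter> Y"
      using that neighbours_sym[OF assms(1), of x y] by simp
    then show ?thesis
      using *(4)[of x] *(5)[of x] that by (cases "x \<in> X1") auto
  qed
  have "neighbours G y \<inter> X = (if y \<in> Y1 then X1 else X - X1)" if "y \<in> Y" for y
    using adj[OF _ that] *(2) by (auto simp: set_eq_iff)
  then have "\<forall>y\<in>Y1. neighbours G y \<inter> X = X1" "\<forall>y\<in>Y - Y1. neighbours G y \<inter> X = X - X1"
    using *(3) by (simp_all add: subset_iff)
  moreover have "bipartition (verts G) Y X"
    using *(1) by (simp add: bipartition_commute)
  ultimately show ?thesis
    unfolding is_bijoin_def by (intro conjI exI[of _ Y1] exI[of _ X1] *(2,3))
qed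

end

theory Submission
  imports Defs
begin

text \<open>
  A matrix has rank at most 1 iff all its \<open>2 \<times> 2\<close> minors vanish
  (\<open>mat_rank_le_1_iff_minors\<close>). This condition is invariant under transposition, so for the
  symmetric matrices \<open>A(G)\<close> and \<open>S(G)\<close> an HL-bipartition is described by the minors with rows
  in \<open>X\<close> and columns in \<open>Y\<close> alone (\<open>hl_bipartition_symmetric_iff\<close>).

  Each of these minors lies in rows \<open>x, x'\<close> and columns \<open>y, y'\<close>, and off the diagonal the entries
  of the two matrices have only two values. Hence each minor condition is a Boolean condition on
  the four possible edges between \<open>{x, x'}\<close> and \<open>{y, y'}\<close>. For entries 0 and 1 it says that two
  vertices of \<open>X\<close> which both have neighbours in \<open>Y\<close> have the same ones, which is a split
  (\<open>split_condition_iff\<close>). For entries \<open>-1\<close> and 1 it says that an even number of the four edges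
  is present, so that any two rows agree everywhere on \<open>Y\<close> or differ everywhere on \<open>Y\<close>, which is
  a bi-join (\<open>bijoin_condition_iff\<close>).
\<close>

section \<open>Rank at most one and two-by-two minors\<close>

lemma det_two_by_two:
  fixes A :: "'a::comm_ring_1 mat"
  assumes A: "A \<in> carrier_mat 2 2"
  shows "det A = A $$ (0, 0) * A $$ (1, 1) - A $$ (0, 1) * A $$ (1, 0)"
proof -
  have "det (mat_delete A i j) = A $$ (1 - i, 1 - j)" if "i < 2" "j < 2" for i j
  proof -
    have "mat_delete A i j \<in> carrier_mat 1 1"
      using A by (auto simp: mat_delete_def)
    then show ?thesis
      using A that by (auto simp: det_single mat_delete_def less_2_cases_iff)
  qed
  then show ?thesis
    using laplace_expansion_row[OF A, of 0] by (simp add: cofactor_def numeral_2_eq_2)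
qed

text \<open>
  A nonzero \<open>2 \<times> 2\<close> minor is the determinant of a submatrix, which bounds the rank from below.
  The ordering hypotheses make the rows and columns of the submatrix appear in the displayed order.
\<close>

lemma minor_eq_if_mat_rank_le_1:
  fixes A :: "'a::field mat"
  assumes rank: "mat_rank A \<le> 1"
    and ik: "i < k" "k < dim_row A" and jl: "j < l" "l < dim_col A"
  shows "A $$ (i, j) * A $$ (k, l) = A $$ (i, l) * A $$ (k, j)"
proof (rule ccontr)
  assume neq: "\<not> ?thesis"
  let ?B = "submatrix A {i, k} {j, l}"
  have "{a. a < dim_row A \<and> a \<in> {i, k}} = {i, k}" "{a. a < dim_col A \<and> a \<in> {j, l}} = {j, l}"
    using ik jl by auto
  then have cards: "card {a. a < dim_row A \<and> a \<in> {i, k}} = 2"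
      "card {a. a < dim_col A \<and> a \<in> {j, l}} = 2"
    using ik jl by simp_all
  then have B: "?B \<in> carrier_mat 2 2"
    by (intro carrier_matI) (simp_all only: dim_submatrix)
  have positions: "{a \<in> {i, k}. a < i} = {}" "{a \<in> {i, k}. a < k} = {i}"
      "{a \<in> {j, l}. a < j} = {}" "{a \<in> {j, l}. a < l} = {j}"
    using ik jl by auto
  have "?B $$ (0, 0) = A $$ (i, j)" "?B $$ (0, 1) = A $$ (i, l)"
      "?B $$ (1, 0) = A $$ (k, j)" "?B $$ (1, 1) = A $$ (k, l)"
    using submatrix_index_card[of i A j "{i, k}" "{j, l}"]
      submatrix_index_card[of i A l "{i, k}" "{j, l}"]
      submatrix_index_card[of k A j "{i, k}" "{j, l}"]
      submatrix_index_card[of k A l "{i, k}" "{j, l}"] ik jl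
    unfolding positions by simp_all
  then have "det ?B \<noteq> 0"
    using neq det_two_by_two[OF B] by simp
  then have "2 \<le> mat_rank A"
    using vec_space.rank_gt_minor[of A "dim_row A" "dim_col A" "{i, k}" "{j, l}"] cards(2)
    unfolding mat_rank_def by simp
  then show False
    using rank by simp
qed

lemma mat_rank_le_1_iff_minors:
  fixes A :: "'a::field mat"
  shows "mat_rank A \<le> 1 \<longleftrightarrow>
    (\<forall>i<dim_row A. \<forall>k<dim_row A. \<forall>j<dim_col A. \<forall>l<dim_col A.
      A $$ (i, j) * A $$ (k, l) = A $$ (i, l) * A $$ (k, j))"
    (is "_ \<longleftrightarrow> ?minors")
proof
  assume rank: "mat_rank A \<le> 1"
  show ?minors
  proof (intro allI impI)
    fix i k j l assume b: "i < dim_row A" "k < dim_row A" "j < dim_col A" "l < dim_col A"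
    show "A $$ (i, j) * A $$ (k, l) = A $$ (i, l) * A $$ (k, j)"
    proof (cases "i = k \<or> j = l")
      case True
      then show ?thesis
        by (auto simp: mult.commute)
    next
      case False
      then consider "i < k" "j < l" | "i < k" "l < j" | "k < i" "j < l" | "k < i" "l < j"
        by linarith
      then show ?thesis
      proof cases
        case 1
        then show ?thesis
          using minor_eq_if_mat_rank_le_1[OF rank, of i k j l] b by blast
      next
        case 2
        then show ?thesis
          using minor_eq_if_mat_rank_le_1[OF rank, of i k l j] b by metis
      next
        case 3
        then show ?thesis
          using minor_eq_if_mat_rank_le_1[OF rank, of k i j l] b by (metis mult.commute)
      next
        case 4
        then show ?thesis
          using minor_eq_if_mat_rank_le_1[OF rank, of k i l j] b by (metis mult.commute)
      qed
    qed
  qed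
next
  assume minors: ?minors
  have "\<exists>f g. \<forall>r<dim_row A. \<forall>c<dim_col A. A $$ (r, c) = f r * g c"
  proof (cases "\<exists>i<dim_row A. \<exists>j<dim_col A. A $$ (i, j) \<noteq> 0")
    case True
    then obtain i j where ij: "i < dim_row A" "j < dim_col A" "A $$ (i, j) \<noteq> 0"
      by blast
    \<comment> \<open>Every row is a multiple of the row through the nonzero entry.\<close>
    have factored: "A $$ (r, c) = (A $$ (r, j) / A $$ (i, j)) * A $$ (i, c)"
      if "r < dim_row A" "c < dim_col A" for r c
      using minors[rule_format, of r i c j] ij that by (simp add: nonzero_eq_divide_eq)
    show ?thesis
      by (intro exI[of _ "\<lambda>r. A $$ (r, j) / A $$ (i, j)"] exI[of _ "\<lambda>c. A $$ (i, c)"]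
          allI impI factored)
  next
    case False
    then show ?thesis
      by (intro exI[of _ "\<lambda>_. 0"]) simp
  qed
  then obtain f g where "\<And>r c. r < dim_row A \<Longrightarrow> c < dim_col A \<Longrightarrow> A $$ (r, c) = f r * g c"
    by blast
  then show "mat_rank A \<le> 1"
    unfolding mat_rank_def
    by (intro vec_space.rank_le_1_product_entries[where nc = "dim_col A"]) auto
qed

section \<open>HL-bipartitions of symmetric matrices\<close>

lemma pick_image_eq:
  assumes "X \<subseteq> {..<n}"
  shows "pick X ` {..<card X} = X"
proof
  have finite: "finite X"
    using assms finite_subset by blast
  show "pick X ` {..<card X} \<subseteq> X"
    using pick_in_set_le[of _ X] by auto
  show "X \<subseteq> pick X ` {..<card X}"
  proof
    fix x assume x: "x \<in> X"
    then have "{a \<in> X. a < x} \<subset> X"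
      by blast
    then have "card {a \<in> X. a < x} < card X"
      using finite by (rule psubset_card_mono[rotated])
    then show "x \<in> pick X ` {..<card X}"
      by (intro image_eqI[where x = "card {a \<in> X. a < x}"]) (simp_all add: pick_card_in_set[OF x])
  qed
qed

lemma mat_rank_submatrix_le_1_iff:
  fixes M :: "'a::field mat"
  assumes X: "X \<subseteq> {..<dim_row M}" and Y: "Y \<subseteq> {..<dim_col M}"
  shows "mat_rank (submatrix M X Y) \<le> 1 \<longleftrightarrow>
    (\<forall>x\<in>X. \<forall>x'\<in>X. \<forall>y\<in>Y. \<forall>y'\<in>Y. M $$ (x, y) * M $$ (x', y') = M $$ (x, y') * M $$ (x', y))"
    (is "_ \<longleftrightarrow> ?R")
proof -
  have sets: "{i. i < dim_row M \<and> i \<in> X} = X" "{j. j < dim_col M \<and> j \<in> Y} = Y"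
    using X Y by auto
  have entry: "submatrix M X Y $$ (i, j) = M $$ (pick X i, pick Y j)"
    if "i < card X" "j < card Y" for i j
    using submatrix_index[of i M X j Y] that unfolding sets by simp
  have "?R \<longleftrightarrow> (\<forall>x\<in>pick X ` {..<card X}. \<forall>x'\<in>pick X ` {..<card X}.
    \<forall>y\<in>pick Y ` {..<card Y}. \<forall>y'\<in>pick Y ` {..<card Y}.
      M $$ (x, y) * M $$ (x', y') = M $$ (x, y') * M $$ (x', y))"
    by (simp only: pick_image_eq[OF X] pick_image_eq[OF Y])
  also have "\<dots> \<longleftrightarrow> mat_rank (submatrix M X Y) \<le> 1"
    unfolding mat_rank_le_1_iff_minors dim_submatrix sets ball_simps(9)
    unfolding Ball_def lessThan_iff by (simp add: entry)
  finally show ?thesis ..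
qed

lemma hl_bipartition_symmetric_iff:
  fixes M :: "'a::field mat"
  assumes M: "M \<in> carrier_mat n n" and bip: "bipartition {..<n} X Y"
    and sym: "\<And>x y. x \<in> X \<Longrightarrow> y \<in> Y \<Longrightarrow> M $$ (y, x) = M $$ (x, y)"
  shows "hl_bipartition M X Y \<longleftrightarrow>
    (\<forall>x\<in>X. \<forall>x'\<in>X. \<forall>y\<in>Y. \<forall>y'\<in>Y. M $$ (x, y) * M $$ (x', y') = M $$ (x, y') * M $$ (x', y))"
proof -
  have "X \<union> Y = {..<n}"
    using bip unfolding bipartition_def partition_on_def by simp
  then have sub: "X \<subseteq> {..<dim_row M}" "X \<subseteq> {..<dim_col M}"
      "Y \<subseteq> {..<dim_row M}" "Y \<subseteq> {..<dim_col M}"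
    using M by auto
  \<comment> \<open>The two blocks are transposes of each other and so have the same minors.\<close>
  have transposed: "M $$ (y, x) * M $$ (y', x') = M $$ (y, x') * M $$ (y', x) \<longleftrightarrow>
      M $$ (x, y) * M $$ (x', y') = M $$ (x, y') * M $$ (x', y)"
    if "y \<in> Y" "y' \<in> Y" "x \<in> X" "x' \<in> X" for x x' y y'
    by (simp only: sym[OF that(3,1)] sym[OF that(3,2)] sym[OF that(4,1)] sym[OF that(4,2)]
        mult.commute[of "M $$ (x', y)" "M $$ (x, y')"])
  have "mat_rank (submatrix M Y X) \<le> 1 \<longleftrightarrow>
    (\<forall>y\<in>Y. \<forall>y'\<in>Y. \<forall>x\<in>X. \<forall>x'\<in>X. M $$ (x, y) * M $$ (x', y') = M $$ (x, y') * M $$ (x', y))"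
    unfolding mat_rank_submatrix_le_1_iff[OF sub(3,2)]
    by (intro ball_cong refl transposed)
  also have "\<dots> \<longleftrightarrow> (\<forall>x\<in>X. \<forall>x'\<in>X. \<forall>y\<in>Y. \<forall>y'\<in>Y.
      M $$ (x, y) * M $$ (x', y') = M $$ (x, y') * M $$ (x', y))"
    by fast
  finally show ?thesis
    unfolding hl_bipartition_def using mat_rank_submatrix_le_1_iff[OF sub(1,4)] M bip by simp
qed

section \<open>Splits and bi-joins as conditions on four edges\<close>

lemma split_condition_iff:
  "(\<exists>X1 Y1. X1 \<subseteq> X \<and> Y1 \<subseteq> Y \<and> (\<forall>x\<in>X1. N x \<inter> Y = Y1) \<and> (\<forall>x\<in>X - X1. N x \<inter> Y = {})) \<longleftrightarrow>
   (\<forall>x\<in>X. \<forall>x'\<in>X. \<forall>y\<in>Y. \<forall>y'\<in>Y. y \<in> N x \<and> y' \<in> N x' \<longleftrightarrow> y' \<in> N x \<and> y \<in> N x')"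
    (is "?split \<longleftrightarrow> ?edges")
proof
  assume ?split
  then obtain X1 Y1 where *: "\<forall>x\<in>X1. N x \<inter> Y = Y1" "\<forall>x\<in>X - X1. N x \<inter> Y = {}"
    by (elim exE conjE)
  have "y \<in> N x \<longleftrightarrow> x \<in> X1 \<and> y \<in> Y1" if "x \<in> X" "y \<in> Y" for x y
    using * that by (cases "x \<in> X1") auto
  then show ?edges
    by auto
next
  assume edges: ?edges
  define X1 where "X1 = {x \<in> X. N x \<inter> Y \<noteq> {}}"
  define Y1 where "Y1 = (\<Union>x\<in>X. N x \<inter> Y)"
  have "N x \<inter> Y = Y1" if "x \<in> X1" for x
    using that edges unfolding X1_def Y1_def by blast
  then show ?split
    by (intro exI[of _ X1] exI[of _ Y1]) (auto simp: X1_def Y1_def)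
qed

text \<open>
  The parts \<open>X1\<close> and \<open>Y1\<close> are read off from one reference vertex of \<open>X\<close>, which therefore must
  exist: with entries \<open>\<plusminus>1\<close> no row is distinguished, as replacing \<open>X1\<close> and \<open>Y1\<close> by their
  complements in \<open>X\<close> and \<open>Y\<close> describes the same bi-join.
\<close>

lemma bijoin_condition_iff:
  assumes "X \<noteq> {}"
  shows "(\<exists>X1 Y1. X1 \<subseteq> X \<and> Y1 \<subseteq> Y \<and>
      (\<forall>x\<in>X1. N x \<inter> Y = Y1) \<and> (\<forall>x\<in>X - X1. N x \<inter> Y = Y - Y1)) \<longleftrightarrow>
    (\<forall>x\<in>X. \<forall>x'\<in>X. \<forall>y\<in>Y. \<forall>y'\<in>Y. (y \<in> N x \<longleftrightarrow> y' \<in> N x') \<longleftrightarrow> (y' \<in> N x \<longleftrightarrow> y \<in> N x'))"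
    (is "?bijoin \<longleftrightarrow> ?edges")
proof
  assume ?bijoin
  then obtain X1 Y1 where *: "\<forall>x\<in>X1. N x \<inter> Y = Y1" "\<forall>x\<in>X - X1. N x \<inter> Y = Y - Y1"
    by (elim exE conjE)
  have "y \<in> N x \<longleftrightarrow> (x \<in> X1 \<longleftrightarrow> y \<in> Y1)" if "x \<in> X" "y \<in> Y" for x y
    using * that by (cases "x \<in> X1") auto
  then show ?edges
    by auto
next
  assume edges: ?edges
  obtain x0 where x0: "x0 \<in> X"
    using assms by blast
  define Y1 where "Y1 = N x0 \<inter> Y"
  define X1 where "X1 = {x \<in> X. N x \<inter> Y = Y1}"
  have "N x \<inter> Y = Y - Y1" if x: "x \<in> X - X1" for x
  proof -
    obtain y where y: "y \<in> Y" "y \<in> N x \<longleftrightarrow> y \<notin> N x0"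
      using x unfolding X1_def Y1_def by blast
    have "y' \<in> N x \<longleftrightarrow> y' \<notin> N x0" if "y' \<in> Y" for y'
      using edges[rule_format, of x x0 y y'] x x0 y that by blast
    then show ?thesis
      unfolding Y1_def by blast
  qed
  then show ?bijoin
    by (intro exI[of _ X1] exI[of _ Y1]) (auto simp: X1_def Y1_def)
qed

section \<open>Splits, bi-joins and HL-bipartitions\<close>

theorem proposition1:
  fixes G :: "(nat, 'b) pre_digraph" and n :: nat and X Y :: "nat set"
  assumes "graph G" and "verts G = {..<n}"
    and "bipartition {..<n} X Y"
  shows "(is_split G X Y \<longleftrightarrow> hl_bipartition (adjacency_matrix n G) X Y) \<and>
         (is_bijoin G X Y \<longleftrightarrow> hl_bipartition (seidel_matrix n G) X Y)"
proof -
  have parts: "X \<union> Y = {..<n}" "X \<inter> Y = {}" "X \<noteq> {}"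
    using assms(3) unfolding bipartition_def partition_on_def disjoint_def by auto
  have indices: "x < n" "y < n" "x \<noteq> y" if "x \<in> X" "y \<in> Y" for x y
    using parts that by auto
  \<comment> \<open>The zero diagonal of the Seidel matrix does not meet the blocks between the disjoint parts.\<close>
  have adjacency: "adjacency_matrix n G $$ (x, y) = (if y \<in> neighbours G x then 1 else 0)"
      "adjacency_matrix n G $$ (y, x) = (if y \<in> neighbours G x then 1 else 0)"
    and seidel: "seidel_matrix n G $$ (x, y) = (if y \<in> neighbours G x then - 1 else 1)"
      "seidel_matrix n G $$ (y, x) = (if y \<in> neighbours G x then - 1 else 1)"
    if "x \<in> X" "y \<in> Y" for x y
    using indices[OF that] neighbours_sym[OF assms(1), of x y]
    unfolding adjacency_matrix_def seidel_matrix_def neighbours_def by auto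
  have carriers: "adjacency_matrix n G \<in> carrier_mat n n" "seidel_matrix n G \<in> carrier_mat n n"
    unfolding adjacency_matrix_def seidel_matrix_def by simp_all
  have "hl_bipartition (adjacency_matrix n G) X Y \<longleftrightarrow>
    (\<forall>x\<in>X. \<forall>x'\<in>X. \<forall>y\<in>Y. \<forall>y'\<in>Y. y \<in> neighbours G x \<and> y' \<in> neighbours G x' \<longleftrightarrow>
      y' \<in> neighbours G x \<and> y \<in> neighbours G x')"
    by (subst hl_bipartition_symmetric_iff[OF carriers(1) assms(3)],
      simp only: adjacency, intro ball_cong refl) (simp add: adjacency)
  moreover have "hl_bipartition (seidel_matrix n G) X Y \<longleftrightarrow>
    (\<forall>x\<in>X. \<forall>x'\<in>X. \<forall>y\<in>Y. \<forall>y'\<in>Y. (y \<in> neighbours G x \<longleftrightarrow> y' \<in> neighbours G x') \<longleftrightarrow>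
      (y' \<in> neighbours G x \<longleftrightarrow> y \<in> neighbours G x'))"
    by (subst hl_bipartition_symmetric_iff[OF carriers(2) assms(3)],
      simp only: seidel, intro ball_cong refl) (simp add: seidel)
  ultimately show ?thesis
    using assms(2,3) split_condition_iff[of X Y "neighbours G"]
      bijoin_condition_iff[OF parts(3), of Y "neighbours G"]
    unfolding is_split_def is_bijoin_def by simp
qed

end
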